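(* Let $\mathbb{T}>1$, $J=[1,\mathbb{T}]$, $0<\rho,k,\gamma<1$, and let $\mathscr{B}=C(J)$ be the space of real-valued continuous functions on $J$ with the supremum norm. Let $\varDelta:J\times\mathbb{R}^2\to\mathbb{R}$ and $\mathscr{H}:J\times\mathbb{R}\to\mathbb{R}$. Assume: (H1) $\varDelta$ and $\mathscr{H}$ are continuous and there exist constants $c_1,c_2,c_3\ge0$ such that $$|\varDelta(x,h,j)-\varDelta(x,\bar h,\bar j)|\le c_1|h-\bar h|+c_2|j-\bar j|\quad (x\in J;\ h,j,\bar h,\bar j\in\mathbb{R})$$ and $$|\mathscr{H}(x,l_1)-\mathscr{H}(x,l_2)|\le c_3|l_1-l_2|\quad(x\in J;\ l_1,l_2\in\mathbb{R}).$$ (H2) There exists $r_0>0$ such that $$\sup\left\{|\varDelta(x,h,j)|: x\in J,\ h\in[-\hat{\mathscr{H}},\hat{\mathscr{H}}],\ j\in[-\hat{\mathscr{J}},\hat{\mathscr{J}}]\right\}\le r_0\quad\text{and}\quad c_1c_3<1,$$ where $\hat{\mathscr{H}}=\sup\{|\mathscr{H}(x,\mathscr{L}(x))|: x\in J,\ \mathscr{L}(x)\in[-r_0,r_0]\}$ and $\hat{\mathscr{J}}=\sup\{|({}^{\rho}_{k}\mathscr{J}^{\gamma}\mathscr{L})(x)|: x\in J,\ \mathscr{L}(x)\in[-r_0,r_0]\}$ (the latter over $\mathscr{L}\in\mathscr{B}$ with values in $[-r_0,r_0]$). (H3) $\max_{x\in J}|\varDelta(x,0,0)|=\mathscr{M}$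 and $\mathscr{H}(x,0)=0$ for all $x\in J$. (H4) The number $r_0$ satisfies $$c_1c_3r_0+\frac{c_2r_0\rho^{-\gamma/k}}{\gamma\,\Gamma_k(\gamma)}\left(\mathbb{T}^{\rho}-1\right)^{\gamma/k}+\mathscr{M}\le r_0.$$ Then the functional integral equation $$\mathscr{L}(x)=\varDelta\left(x,\mathscr{H}(x,\mathscr{L}(x)),({}^{\rho}_{k}\mathscr{J}^{\gamma}\mathscr{L})(x)\right),\qquad x\in J,$$ has at least one solution $\mathscr{L}\in\mathscr{B}=C(J)$.
   Context: For a continuous function $\phi$ on $[1,\mathbb{T}]$, the $(k,\rho)$-fractional Hilfer integral is $$({}^{\rho}_{k}\mathscr{J}^{\gamma}\phi)(x)=\frac{\rho^{1-\gamma/k}}{k\,\Gamma_k(\gamma)}\int_1^x\frac{t^{\rho-1}}{(x^\rho-t^\rho)^{1-\gamma/k}}\,\phi(t)\,dt,$$ with value $0$ at $x=1$. Here $\Gamma_k$ is the $k$-gamma function, $\Gamma_k(\gamma)=\int_0^\infty t^{\gamma-1}e^{-t^k/k}\,dt$ for $\gamma>0$. *)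

theory Defs
  imports "HOL-Analysis.Analysis"
begin

definition k_Gamma :: "real \<Rightarrow> real \<Rightarrow> real" where
  "k_Gamma k g = (LBINT t:{0<..}. t powr (g - 1) * exp (- (t powr k) / k))"

(* The value of the integrand at the singular endpoint t = x is immaterial (null set). *)
definition hilfer_integral ::
    "real \<Rightarrow> real \<Rightarrow> real \<Rightarrow> (real \<Rightarrow> real) \<Rightarrow> real \<Rightarrow> real" where
  "hilfer_integral \<rho> k g \<phi> x =
     \<rho> powr (1 - g / k) / (k * k_Gamma k g) *
     (LBINT t:{1..x}. t powr (\<rho> - 1) / (x powr \<rho> - t powr \<rho>) powr (1 - g / k) * \<phi> t)"

lemma hilfer_integral_1: "hilfer_integral \<rho> k g \<phi> 1 = 0"
proof -
  have "(LBINT t:{1..1::real}. t powr (\<rho> - 1) / (1 powr \<rho> - t powr \<rho>) powr (1 - g / k) * \<phi> t)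
      = (LBINT t:{1..1::real}. 0)"
    by (intro set_lebesgue_integral_cong) auto
  then show ?thesis
    by (simp add: hilfer_integral_def)
qed

(* The two suprema below are taken over nonempty sets that are bounded above whenever H is
   continuous on [1,T] x R and rho, k, g > 0, so Sup on the reals is the true supremum. *)

definition H_hat :: "real \<Rightarrow> (real \<Rightarrow> real \<Rightarrow> real) \<Rightarrow> real \<Rightarrow> real" where
  "H_hat T H r = Sup {\<bar>H x l\<bar> | x l. x \<in> {1..T} \<and> l \<in> {-r..r}}"

definition J_hat :: "real \<Rightarrow> real \<Rightarrow> real \<Rightarrow> real \<Rightarrow> real \<Rightarrow> real" where
  "J_hat T \<rho> k g r =
     Sup {\<bar>hilfer_integral \<rho> k g L x\<bar> | x L.
            x \<in> {1..T} \<and> continuous_on {1..T} L \<and> (\<forall>y\<in>{1..T}. L y \<in> {-r..r})}"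

end

theory Submission
  imports Defs
begin

text \<open>
  For \<open>M > 0\<close> the inequality (H4), divided by \<open>r0\<close>, says that the right-hand side of the equation is a
  contraction on \<open>C[1,T]\<close> with constant \<open>c1 c3 + c2 K \<le> 1 - M / r0\<close>, where \<open>K\<close> is the explicit sup-norm
  bound of the fractional integral. For \<open>M = 0\<close> the zero
  function is a solution. The fractional integral preserves continuity because the kernel and the
  modulus of the difference of two kernels have closed-form integrals.
\<close>

section \<open>Banach's fixed point theorem for continuous functions on an interval\<close>

text \<open>Bounded continuous functions on the whole line form a complete metric space as a type,
  so the Banach theorem is applied there. Precomposing \<open>F f\<close> with the clamp
  \<open>p\<close> onto \<open>{a..b}\<close> keeps the map inside this type. Phrasing the Lipschitz
  hypothesis with an arbitrary pointwise bound \<open>d\<close> avoids a sup norm on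
  \<open>{a..b}\<close>.\<close>

lemma contraction_fixpoint_Icc:
  fixes F :: "(real \<Rightarrow> real) \<Rightarrow> real \<Rightarrow> real"
  assumes ab: "a \<le> b" and c: "0 \<le> c" "c < 1"
    and cont: "\<And>f. continuous_on {a..b} f \<Longrightarrow> continuous_on {a..b} (F f)"
    and contr: "\<And>f g d x. continuous_on {a..b} f \<Longrightarrow> continuous_on {a..b} g \<Longrightarrow>
      (\<And>y. y \<in> {a..b} \<Longrightarrow> \<bar>f y - g y\<bar> \<le> d) \<Longrightarrow> x \<in> {a..b} \<Longrightarrow> \<bar>F f x - F g x\<bar> \<le> c * d"
  obtains f where "continuous_on {a..b} f" "\<And>x. x \<in> {a..b} \<Longrightarrow> F f x = f x"
proof -
  define p where "p x = max a (min b x)" for x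
  have p_in: "p x \<in> {a..b}" for x using ab by (auto simp: p_def)
  have p_id: "p x = x" if "x \<in> {a..b}" for x using that by (auto simp: p_def)
  have p_cont: "continuous_on UNIV p" unfolding p_def by (intro continuous_intros)
  define G where "G f = Bcontfun (\<lambda>x. F (apply_bcontfun f) (p x))" for f
  have cont_f: "continuous_on {a..b} (apply_bcontfun f)" for f :: "real \<Rightarrow>\<^sub>C real"
    by (rule continuous_on_apply_bcontfun)
  have G: "apply_bcontfun (G f) x = F (apply_bcontfun f) (p x)" for f x
  proof -
    have "bounded (F (apply_bcontfun f) ` {a..b})"
      by (intro compact_imp_bounded compact_continuous_image cont cont_f) auto
    then have "bounded (range (\<lambda>x. F (apply_bcontfun f) (p x)))"
      by (rule bounded_subset) (use p_in in auto)
    moreover have "continuous_on UNIV (\<lambda>x. F (apply_bcontfun f) (p x))"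
      by (rule continuous_on_compose2[OF cont[OF cont_f] p_cont]) (use p_in in auto)
    ultimately show ?thesis
      unfolding G_def by (subst Bcontfun_inverse) (auto simp: bcontfun_def)
  qed
  have "\<exists>!f. G f = f"
  proof (rule banach_fix_type[OF c], intro allI)
    fix f g
    show "dist (G f) (G g) \<le> c * dist f g"
    proof (rule dist_bound)
      fix x
      show "dist (G f x) (G g x) \<le> c * dist f g"
        unfolding G dist_real_def
        \<comment> \<open>The role of \<open>d\<close> is taken by \<open>dist f g\<close>, the sup
          distance over the whole line, which dominates the differences on
          \<open>{a..b}\<close>.\<close>
        by (rule contr[OF cont_f cont_f _ p_in]) (metis dist_bounded dist_real_def)
    qed
  qed
  then obtain f where f: "G f = f" by blast
  show thesis
  proof (rule that[OF cont_f])
    show "F (apply_bcontfun f) x = apply_bcontfun f x" if "x \<in> {a..b}" for x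
      using G[of f x] f p_id[OF that] by simp
  qed
qed

section \<open>Integrals of the kernel and their continuity in the upper limit\<close>

text \<open>Here \<open>a\<close> stands for \<open>g / k\<close>. Since \<open>g\<close> and
  \<open>k\<close> both range over (0,1), \<open>a\<close> may exceed 1, and then there is no
  singularity at \<open>t = x\<close>. In every case the value at \<open>t = x\<close> is 0, by the
  conventions for \<open>powr\<close> and division.\<close>

definition hilfer_kernel :: "real \<Rightarrow> real \<Rightarrow> real \<Rightarrow> real \<Rightarrow> real" where
  "hilfer_kernel \<rho> a x t = t powr (\<rho> - 1) / (x powr \<rho> - t powr \<rho>) powr (1 - a)"

lemma hilfer_kernel_nonneg: "0 \<le> hilfer_kernel \<rho> a x t"
  by (simp add: hilfer_kernel_def)

lemma hilfer_kernel_measurable [measurable]: "hilfer_kernel \<rho> a x \<in> borel_measurable borel"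
  unfolding hilfer_kernel_def by measurable

context
  fixes \<rho> a :: real
  assumes \<rho>: "0 < \<rho>" and a: "0 < a"
begin

text \<open>The antiderivative \<open>P\<close> is continuous up to \<open>t = x\<close> because
  \<open>a > 0\<close>, although it may fail to be differentiable there. The fundamental theorem
  with derivatives only in the interior therefore covers the improper integral without a limit
  argument.\<close>

lemma has_integral_hilfer_kernel:
  assumes "0 < p" "p \<le> q" "q \<le> x"
  shows "(hilfer_kernel \<rho> a x has_integral
    ((x powr \<rho> - p powr \<rho>) powr a - (x powr \<rho> - q powr \<rho>) powr a) / (\<rho> * a)) {p..q}"
proof -
  define P where "P t = - ((x powr \<rho> - t powr \<rho>) powr a / (\<rho> * a))" for t
  have "(hilfer_kernel \<rho> a x has_integral P q - P p) {p..q}"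
  proof (rule fundamental_theorem_of_calculus_interior[OF assms(2)])
    show "continuous_on {p..q} P"
      unfolding P_def using assms \<rho> a
      by (intro continuous_intros continuous_on_powr') (auto intro!: powr_mono2)
    fix t assume t: "t \<in> {p<..<q}"
    then have pos: "0 < x powr \<rho> - t powr \<rho>" and t0: "0 < t"
      using assms \<rho> by (auto intro!: powr_less_mono2)
    have "(P has_real_derivative
        - (a * (x powr \<rho> - t powr \<rho>) powr (a - 1) * (- (\<rho> * t powr (\<rho> - 1))) / (\<rho> * a))) (at t)"
      unfolding P_def using pos t0
      by (auto intro!: derivative_eq_intros)
    also have "- (a * (x powr \<rho> - t powr \<rho>) powr (a - 1) * (- (\<rho> * t powr (\<rho> - 1))) / (\<rho> * a))
        = hilfer_kernel \<rho> a x t"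
      using \<rho> a powr_minus_divide[of "x powr \<rho> - t powr \<rho>" "1 - a"]
      by (simp add: hilfer_kernel_def)
    finally show "(P has_vector_derivative hilfer_kernel \<rho> a x t) (at t)"
      by (simp add: has_real_derivative_iff_has_vector_derivative)
  qed
  then show ?thesis by (simp add: P_def diff_divide_distrib)
qed

text \<open>A nonnegative function with a gauge integral is absolutely integrable; Borel
  measurability then carries this from the completed measure to \<open>lborel\<close>.\<close>

lemma set_integrable_hilfer_kernel:
  assumes "0 < p" "p \<le> q" "q \<le> x"
  shows "set_integrable lborel {p..q} (hilfer_kernel \<rho> a x)"
proof -
  have "hilfer_kernel \<rho> a x absolutely_integrable_on {p..q}"
    using has_integral_hilfer_kernel[OF assms]
    by (intro nonnegative_absolutely_integrable_1) (auto simp: hilfer_kernel_nonneg)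
  then show ?thesis
    unfolding set_integrable_def by (subst (asm) integrable_completion) auto
qed

lemma set_integrable_hilfer_kernel_mult:
  fixes \<phi> :: "real \<Rightarrow> real"
  assumes pq: "0 < p" "p \<le> q" "q \<le> x" and \<phi>: "continuous_on {p..q} \<phi>"
  shows "set_integrable lborel {p..q} (\<lambda>t. hilfer_kernel \<rho> a x t * \<phi> t)"
proof -
  have "bounded (\<phi> ` {p..q})"
    by (intro compact_imp_bounded compact_continuous_image \<phi>) auto
  then obtain B where B: "\<And>t. t \<in> {p..q} \<Longrightarrow> \<bar>\<phi> t\<bar> \<le> B"
    unfolding bounded_iff by auto (metis atLeastAtMost_iff)
  \<comment> \<open>Continuity of \<open>\<phi>\<close> is known on \<open>{p..q}\<close> only, so
    the indicator is attached to \<open>\<phi>\<close> to get a Borel function on the line. The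
    product is then dominated by a multiple of the kernel.\<close>
  have m: "(\<lambda>t. indicator {p..q} t *\<^sub>R \<phi> t) \<in> borel_measurable borel"
    by (intro borel_measurable_continuous_on_indicator \<phi>) simp
  have eq: "indicator {p..q} t *\<^sub>R (hilfer_kernel \<rho> a x t * \<phi> t)
      = hilfer_kernel \<rho> a x t * (indicator {p..q} t *\<^sub>R \<phi> t)" for t
    by simp
  have "integrable lborel (\<lambda>t. B * (indicator {p..q} t *\<^sub>R hilfer_kernel \<rho> a x t))"
    using set_integrable_hilfer_kernel[OF pq] unfolding set_integrable_def
    by (rule integrable_mult_right)
  then show ?thesis
    unfolding set_integrable_def
  proof (rule Bochner_Integration.integrable_bound)
    show "(\<lambda>t. indicator {p..q} t *\<^sub>R (hilfer_kernel \<rho> a x t * \<phi> t)) \<in> borel_measurable lborel"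
      unfolding eq using m by measurable
    show "AE t in lborel. norm (indicator {p..q} t *\<^sub>R (hilfer_kernel \<rho> a x t * \<phi> t))
        \<le> norm (B * (indicator {p..q} t *\<^sub>R hilfer_kernel \<rho> a x t))"
    proof (rule AE_I2)
      fix t
      show "norm (indicator {p..q} t *\<^sub>R (hilfer_kernel \<rho> a x t * \<phi> t))
        \<le> norm (B * (indicator {p..q} t *\<^sub>R hilfer_kernel \<rho> a x t))"
        using B[of t] mult_left_mono[of "\<bar>\<phi> t\<bar>" "\<bar>B\<bar>" "hilfer_kernel \<rho> a x t"]
          hilfer_kernel_nonneg[of \<rho> a x t]
        by (cases "t \<in> {p..q}") (auto simp: abs_mult mult.commute)
    qed
  qed
qed

lemmas hilfer_kernel_mult_integrable_on =
  set_borel_integral_eq_integral(1)[OF set_integrable_hilfer_kernel_mult]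

text \<open>Used twice: on \<open>{x..y}\<close> with upper limit \<open>y\<close> for the tail in
  the continuity estimate, and on \<open>{1..x}\<close> for the sup-norm bound.\<close>

lemma hilfer_kernel_mult_bound:
  fixes \<phi> :: "real \<Rightarrow> real"
  assumes pq: "0 < p" "p \<le> q" "q \<le> x" and \<phi>: "continuous_on {p..q} \<phi>"
    and B: "\<And>t. t \<in> {p..q} \<Longrightarrow> \<bar>\<phi> t\<bar> \<le> B"
  shows "\<bar>integral {p..q} (\<lambda>t. hilfer_kernel \<rho> a x t * \<phi> t)\<bar>
    \<le> ((x powr \<rho> - p powr \<rho>) powr a - (x powr \<rho> - q powr \<rho>) powr a) / (\<rho> * a) * B"
proof -
  note I = has_integral_mult_left[OF has_integral_hilfer_kernel[OF pq], of B]
  have "norm (integral {p..q} (\<lambda>t. hilfer_kernel \<rho> a x t * \<phi> t))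
      \<le> integral {p..q} (\<lambda>t. hilfer_kernel \<rho> a x t * B)"
    using I B
    by (intro integral_norm_bound_integral hilfer_kernel_mult_integrable_on[OF pq \<phi>])
      (auto simp: abs_mult hilfer_kernel_nonneg intro!: mult_left_mono)
  then show ?thesis using integral_unique[OF I] by simp
qed

text \<open>The sign of the kernel difference in \<open>t\<close> depends only on whether \<open>a \<le> 1\<close>, so the
  integral of its absolute value is again explicit.\<close>

lemma has_integral_abs_hilfer_kernel_diff:
  assumes pxy: "0 < p" "p \<le> x" "x \<le> y"
  shows "((\<lambda>t. \<bar>hilfer_kernel \<rho> a y t - hilfer_kernel \<rho> a x t\<bar>) has_integral
    \<bar>((y powr \<rho> - p powr \<rho>) powr a - (y powr \<rho> - x powr \<rho>) powr a
      - (x powr \<rho> - p powr \<rho>) powr a) / (\<rho> * a)\<bar>) {p..x}"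
    (is "(?f has_integral \<bar>?I\<bar>) _")
proof -
  let ?d = "\<lambda>t. hilfer_kernel \<rho> a y t - hilfer_kernel \<rho> a x t"
  have d: "(?d has_integral ?I) {p..x}"
    using has_integral_diff[OF has_integral_hilfer_kernel[OF pxy]
        has_integral_hilfer_kernel[OF pxy(1,2) order_refl]]
    by (simp add: diff_divide_distrib)
  \<comment> \<open>The point \<open>t = x\<close> is left out: the kernel for \<open>x\<close> is 0
    there by convention, which can break the comparison when \<open>a \<le> 1\<close>. A single
    point does not affect the integrals.\<close>
  have base: "0 < x powr \<rho> - t powr \<rho>" "x powr \<rho> - t powr \<rho> \<le> y powr \<rho> - t powr \<rho>"
    if "t \<in> {p..x} - {x}" for t
    using that pxy \<rho> by (auto intro!: powr_less_mono2 powr_mono2)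
  show ?thesis
  proof (cases "a \<le> 1")
    case True
    have eq: "?f t = - ?d t" if t: "t \<in> {p..x} - {x}" for t
    proof -
      have "hilfer_kernel \<rho> a y t \<le> hilfer_kernel \<rho> a x t"
        unfolding hilfer_kernel_def using base[OF t] True
        by (intro divide_left_mono powr_mono2) auto
      then show ?thesis by simp
    qed
    have *: "(?f has_integral - ?I) {p..x}"
      by (rule has_integral_spike_finite[of "{x}", OF _ eq has_integral_neg[OF d]]) simp_all
    \<comment> \<open>The sign of \<open>?I\<close> is not computed; it is read off from the
      integral of a nonnegative function.\<close>
    have "\<bar>?I\<bar> = - ?I"
      using has_integral_nonneg[OF *] by linarith
    with * show ?thesis by (simp only:)
  next
    case False
    have eq: "?f t = ?d t" if t: "t \<in> {p..x} - {x}" for t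
    proof -
      have "hilfer_kernel \<rho> a x t \<le> hilfer_kernel \<rho> a y t"
        unfolding hilfer_kernel_def using base[OF t] False
        by (intro divide_left_mono powr_mono2') auto
      then show ?thesis by simp
    qed
    have *: "(?f has_integral ?I) {p..x}"
      by (rule has_integral_spike_finite[of "{x}", OF _ eq d]) simp_all
    have "\<bar>?I\<bar> = ?I"
      using has_integral_nonneg[OF *] by linarith
    with * show ?thesis by (simp only:)
  qed
qed

text \<open>Splitting \<open>{1..y}\<close> at \<open>x\<close> leaves a tail over
  \<open>{x..y}\<close> and a difference of two kernels over \<open>{1..x}\<close>, both with
  explicit integrals. The resulting bound is symmetric in \<open>x\<close> and \<open>y\<close>, so
  one function serves approach from either side.\<close>

lemma hilfer_kernel_integral_diff_bound:
  fixes \<phi> :: "real \<Rightarrow> real"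
  assumes xy: "1 \<le> x" "x \<le> y" and \<phi>: "continuous_on {1..y} \<phi>"
    and B: "\<And>t. t \<in> {1..y} \<Longrightarrow> \<bar>\<phi> t\<bar> \<le> B"
  shows "\<bar>integral {1..y} (\<lambda>t. hilfer_kernel \<rho> a y t * \<phi> t)
      - integral {1..x} (\<lambda>t. hilfer_kernel \<rho> a x t * \<phi> t)\<bar>
    \<le> (2 * \<bar>y powr \<rho> - x powr \<rho>\<bar> powr a
      + \<bar>(y powr \<rho> - 1) powr a - (x powr \<rho> - 1) powr a\<bar>) / (\<rho> * a) * B"
proof -
  let ?Ky = "\<lambda>t. hilfer_kernel \<rho> a y t * \<phi> t" and ?Kx = "\<lambda>t. hilfer_kernel \<rho> a x t * \<phi> t"
  have \<phi>x: "continuous_on {1..x} \<phi>" and \<phi>y: "continuous_on {x..y} \<phi>"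
    using \<phi> xy by (auto elim: continuous_on_subset)
  have B0: "0 \<le> B" using B[of 1] xy by fastforce
  have pos: "0 \<le> y powr \<rho> - x powr \<rho>" using xy \<rho> by (auto intro: powr_mono2)
  have iy: "?Ky integrable_on {1..y}" "?Ky integrable_on {1..x}"
    and ix: "?Kx integrable_on {1..x}"
    using xy \<phi> \<phi>x by (auto intro!: hilfer_kernel_mult_integrable_on)
  have split: "integral {1..y} ?Ky = integral {1..x} ?Ky + integral {x..y} ?Ky"
    using Henstock_Kurzweil_Integration.integral_combine[OF xy iy(1)] by simp
  have tail: "\<bar>integral {x..y} ?Ky\<bar> \<le> (y powr \<rho> - x powr \<rho>) powr a / (\<rho> * a) * B"
    using hilfer_kernel_mult_bound[of x y y \<phi> B] xy \<phi>y B by auto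
  have "0 < (1::real)" by simp
  note D = has_integral_mult_left[OF has_integral_abs_hilfer_kernel_diff[OF this xy], of B]
  have "norm (integral {1..x} (\<lambda>t. ?Ky t - ?Kx t))
      \<le> integral {1..x} (\<lambda>t. \<bar>hilfer_kernel \<rho> a y t - hilfer_kernel \<rho> a x t\<bar> * B)"
  proof (rule integral_norm_bound_integral)
    fix t assume "t \<in> {1..x}"
    then show "norm (?Ky t - ?Kx t) \<le> \<bar>hilfer_kernel \<rho> a y t - hilfer_kernel \<rho> a x t\<bar> * B"
      using B[of t] xy by (auto simp: abs_mult left_diff_distrib[symmetric] intro!: mult_left_mono)
  qed (use D iy ix in \<open>auto intro: integrable_diff\<close>)
  then have main: "\<bar>integral {1..x} ?Ky - integral {1..x} ?Kx\<bar>
      \<le> \<bar>(y powr \<rho> - 1) powr a - (y powr \<rho> - x powr \<rho>) powr a - (x powr \<rho> - 1) powr a\<bar> / (\<rho> * a) * B"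
    using integral_unique[OF D] integral_diff[OF iy(2) ix] \<rho> a by (simp add: abs_mult)
  \<comment> \<open>The triangle inequality splits off
    \<open>(y powr \<rho> - x powr \<rho>) powr a\<close>; the tail contributes the same term,
    whence the factor 2.\<close>
  also have "\<dots> \<le> ((y powr \<rho> - x powr \<rho>) powr a
      + \<bar>(y powr \<rho> - 1) powr a - (x powr \<rho> - 1) powr a\<bar>) / (\<rho> * a) * B"
    using \<rho> a B0 powr_ge_zero[of "y powr \<rho> - x powr \<rho>" a]
    by (intro mult_right_mono divide_right_mono) (auto simp del: powr_ge_zero)
  finally have "\<bar>integral {1..y} ?Ky - integral {1..x} ?Kx\<bar>
      \<le> (y powr \<rho> - x powr \<rho>) powr a / (\<rho> * a) * B
        + ((y powr \<rho> - x powr \<rho>) powr a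
          + \<bar>(y powr \<rho> - 1) powr a - (x powr \<rho> - 1) powr a\<bar>) / (\<rho> * a) * B"
    using split tail by linarith
  also have "\<dots> = (2 * \<bar>y powr \<rho> - x powr \<rho>\<bar> powr a
      + \<bar>(y powr \<rho> - 1) powr a - (x powr \<rho> - 1) powr a\<bar>) / (\<rho> * a) * B"
    unfolding abs_of_nonneg[OF pos] by (simp only: distrib_right[symmetric] add_divide_distrib[symmetric]) simp
  finally show ?thesis .
qed

lemma continuous_on_hilfer_kernel_integral:
  fixes \<phi> :: "real \<Rightarrow> real"
  assumes \<phi>: "continuous_on {1..T} \<phi>"
  shows "continuous_on {1..T} (\<lambda>x. integral {1..x} (\<lambda>t. hilfer_kernel \<rho> a x t * \<phi> t))"
    (is "continuous_on _ ?S")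
  unfolding continuous_on_def
proof
  fix x assume x: "x \<in> {1..T}"
  have "bounded (\<phi> ` {1..T})"
    by (intro compact_imp_bounded compact_continuous_image \<phi>) auto
  then obtain B where B: "\<And>t. t \<in> {1..T} \<Longrightarrow> \<bar>\<phi> t\<bar> \<le> B"
    unfolding bounded_iff by auto (metis atLeastAtMost_iff)
  define b where "b y = (2 * \<bar>y powr \<rho> - x powr \<rho>\<bar> powr a
      + \<bar>(y powr \<rho> - 1) powr a - (x powr \<rho> - 1) powr a\<bar>) / (\<rho> * a) * B" for y
  have bound: "\<bar>?S y - ?S x\<bar> \<le> b y" if y: "y \<in> {1..T}" for y
  proof (cases "x \<le> y")
    case True
    then show ?thesis
      unfolding b_def using x y B
      by (intro hilfer_kernel_integral_diff_bound) (auto intro: continuous_on_subset[OF \<phi>])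
  next
    case False
    then have "\<bar>?S x - ?S y\<bar> \<le> (2 * \<bar>x powr \<rho> - y powr \<rho>\<bar> powr a
      + \<bar>(x powr \<rho> - 1) powr a - (y powr \<rho> - 1) powr a\<bar>) / (\<rho> * a) * B"
      using x y B
      by (intro hilfer_kernel_integral_diff_bound) (auto intro: continuous_on_subset[OF \<phi>])
    then show ?thesis unfolding b_def by (simp add: abs_minus_commute)
  qed
  \<comment> \<open>The bases may vanish, at \<open>y = x\<close> and at \<open>y = 1\<close>;
    \<open>a > 0\<close> keeps the powers continuous there.\<close>
  have "continuous_on {1..T} b"
    unfolding b_def using \<rho> a
    by (intro continuous_intros continuous_on_powr') (auto intro!: ge_one_powr_ge_zero)
  then have "(b \<longlongrightarrow> b x) (at x within {1..T})" using x by (simp add: continuous_on_def)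
  moreover have "b x = 0" by (simp add: b_def)
  ultimately have "(b \<longlongrightarrow> 0) (at x within {1..T})" by simp
  then have "((\<lambda>y. ?S y - ?S x) \<longlongrightarrow> 0) (at x within {1..T})"
    by (rule Lim_null_comparison[rotated]) (use bound in \<open>auto simp: eventually_at_filter\<close>)
  then show "(?S \<longlongrightarrow> ?S x) (at x within {1..T})" by (simp add: LIM_zero_iff)
qed

end

section \<open>The fractional integral: continuity, linearity and sup-norm bound\<close>

text \<open>This replaces positivity of the Gamma factor: if \<open>k_Gamma k g\<close> were \<open>0\<close>, division by zero would make both the
  fractional integral and its bound vanish.\<close>

lemma k_Gamma_nonneg: "0 \<le> k_Gamma k g"
  unfolding k_Gamma_def set_lebesgue_integral_def by (intro integral_nonneg_AE) auto

context
  fixes \<rho> k g :: real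
  assumes pos: "0 < \<rho>" "0 < k" "0 < g"
begin

text \<open>Passes from the Lebesgue integral of the definition to the gauge integral in which the
  kernel estimates are stated.\<close>

lemma hilfer_integral_eq:
  assumes "1 \<le> x" "continuous_on {1..x} \<phi>"
  shows "hilfer_integral \<rho> k g \<phi> x = \<rho> powr (1 - g / k) / (k * k_Gamma k g)
    * integral {1..x} (\<lambda>t. hilfer_kernel \<rho> (g / k) x t * \<phi> t)"
  using set_borel_integral_eq_integral(2)[OF set_integrable_hilfer_kernel_mult, of \<rho> "g / k" 1 x x \<phi>]
    assms pos
  by (simp add: hilfer_integral_def hilfer_kernel_def)

lemma continuous_on_hilfer_integral:
  assumes \<phi>: "continuous_on {1..T} \<phi>"
  shows "continuous_on {1..T} (hilfer_integral \<rho> k g \<phi>)"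
proof -
  have "continuous_on {1..T} (\<lambda>x. \<rho> powr (1 - g / k) / (k * k_Gamma k g)
      * integral {1..x} (\<lambda>t. hilfer_kernel \<rho> (g / k) x t * \<phi> t))"
    using pos by (intro continuous_intros continuous_on_hilfer_kernel_integral \<phi>) auto
  then show ?thesis
    by (rule continuous_on_eq)
      (use continuous_on_subset[OF \<phi>] in \<open>simp add: hilfer_integral_eq\<close>)
qed

text \<open>Reduces the Lipschitz estimate for the fractional integral to the bound below, applied
  to a difference of functions.\<close>

lemma hilfer_integral_diff:
  assumes "1 \<le> x" "continuous_on {1..x} \<phi>" "continuous_on {1..x} \<psi>"
  shows "hilfer_integral \<rho> k g (\<lambda>t. \<phi> t - \<psi> t) x
    = hilfer_integral \<rho> k g \<phi> x - hilfer_integral \<rho> k g \<psi> x"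
proof -
  have "(\<lambda>t. hilfer_kernel \<rho> (g / k) x t * \<phi> t) integrable_on {1..x}"
    "(\<lambda>t. hilfer_kernel \<rho> (g / k) x t * \<psi> t) integrable_on {1..x}"
    using assms pos by (auto intro!: hilfer_kernel_mult_integrable_on)
  from integral_diff[OF this] show ?thesis
    using assms by (simp add: hilfer_integral_eq continuous_on_diff right_diff_distrib)
qed

text \<open>The kernel has integral
  \<open>(x powr \<rho> - 1) powr (g / k) / (\<rho> * (g / k))\<close> over \<open>{1..x}\<close>,
  which increases with \<open>x\<close> and is replaced by its value at \<open>T\<close>. Cancelling
  \<open>\<rho>\<close> and \<open>k\<close> against the prefactor produces the constant that
  appears in \<open>H4\<close>.\<close>

lemma hilfer_integral_bound:
  assumes x: "x \<in> {1..T}" and \<phi>: "continuous_on {1..x} \<phi>"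
    and B: "\<And>t. t \<in> {1..x} \<Longrightarrow> \<bar>\<phi> t\<bar> \<le> B"
  shows "\<bar>hilfer_integral \<rho> k g \<phi> x\<bar>
    \<le> \<rho> powr (- g / k) / (g * k_Gamma k g) * (T powr \<rho> - 1) powr (g / k) * B"
proof -
  let ?C = "\<rho> powr (1 - g / k) / (k * k_Gamma k g)"
  have C: "0 \<le> ?C" using pos by (simp add: k_Gamma_nonneg)
  have B0: "0 \<le> B" using B[of 1] x by fastforce
  have "\<bar>hilfer_integral \<rho> k g \<phi> x\<bar>
      = ?C * \<bar>integral {1..x} (\<lambda>t. hilfer_kernel \<rho> (g / k) x t * \<phi> t)\<bar>"
    using x C by (simp only: hilfer_integral_eq[OF _ \<phi>] abs_mult abs_of_nonneg atLeastAtMost_iff)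
  also have "\<dots> \<le> ?C * ((x powr \<rho> - 1) powr (g / k) / (\<rho> * (g / k)) * B)"
    using hilfer_kernel_mult_bound[of \<rho> "g / k" 1 x x \<phi> B] x pos \<phi> B
    by (intro mult_left_mono C) auto
  also have "\<dots> \<le> ?C * ((T powr \<rho> - 1) powr (g / k) / (\<rho> * (g / k)) * B)"
    using x pos B0
    by (intro mult_left_mono mult_right_mono divide_right_mono C powr_mono2)
      (auto intro!: powr_mono2 ge_one_powr_ge_zero)
  also have "\<dots> = \<rho> powr (- g / k) / (g * k_Gamma k g) * (T powr \<rho> - 1) powr (g / k) * B"
  proof -
    have "\<rho> powr (1 - g / k) = \<rho> * \<rho> powr (- g / k)"
      using pos powr_add[of \<rho> 1 "- g / k"] by simp
    then show ?thesis using pos by (simp add: field_simps)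
  qed
  finally show ?thesis .
qed

end

section \<open>Existence of a solution\<close>

theorem theorem4p1:
  fixes T \<rho> k \<gamma> c1 c2 c3 r0 M :: real
    and \<Delta> :: "real \<Rightarrow> real \<Rightarrow> real \<Rightarrow> real"
    and H :: "real \<Rightarrow> real \<Rightarrow> real"
  assumes T: "T > 1"
    and rho: "0 < \<rho>" "\<rho> < 1"
    and k: "0 < k" "k < 1"
    and gamma: "0 < \<gamma>" "\<gamma> < 1"
    and H1_cont:
      "continuous_on ({1..T} \<times> UNIV \<times> UNIV) (\<lambda>(x, h, j). \<Delta> x h j)"
      "continuous_on ({1..T} \<times> UNIV) (\<lambda>(x, l). H x l)"
    and H1_const: "c1 \<ge> 0" "c2 \<ge> 0" "c3 \<ge> 0"
    and H1_Delta: "\<And>x h j h' j'. x \<in> {1..T} \<Longrightarrow>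
      \<bar>\<Delta> x h j - \<Delta> x h' j'\<bar> \<le> c1 * \<bar>h - h'\<bar> + c2 * \<bar>j - j'\<bar>"
    and H1_H: "\<And>x l1 l2. x \<in> {1..T} \<Longrightarrow> \<bar>H x l1 - H x l2\<bar> \<le> c3 * \<bar>l1 - l2\<bar>"
    and r0: "r0 > 0"
    and H2_sup: "Sup {\<bar>\<Delta> x h j\<bar> | x h j. x \<in> {1..T} \<and>
        h \<in> {- H_hat T H r0..H_hat T H r0} \<and>
        j \<in> {- J_hat T \<rho> k \<gamma> r0..J_hat T \<rho> k \<gamma> r0}} \<le> r0"
    and H2_c: "c1 * c3 < 1"
    and H3_max: "\<exists>x\<in>{1..T}. \<bar>\<Delta> x 0 0\<bar> = M" "\<And>x. x \<in> {1..T} \<Longrightarrow> \<bar>\<Delta> x 0 0\<bar> \<le> M"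
    and H3_zero: "\<And>x. x \<in> {1..T} \<Longrightarrow> H x 0 = 0"
    and H4: "c1 * c3 * r0
      + c2 * r0 * \<rho> powr (- \<gamma> / k) / (\<gamma> * k_Gamma k \<gamma>) * (T powr \<rho> - 1) powr (\<gamma> / k)
      + M \<le> r0"
  shows "\<exists>L. continuous_on {1..T} L \<and>
    (\<forall>x\<in>{1..T}. L x = \<Delta> x (H x (L x)) (hilfer_integral \<rho> k \<gamma> L x))"
proof (cases "M = 0")
  case True
  \<comment> \<open>For \<open>M = 0\<close>, \<open>H4\<close> would give only a Lipschitz constant
    at most 1. But then \<open>\<Delta> x 0 0\<close> vanishes for every \<open>x\<close> in
    \<open>{1..T}\<close>, and both inner terms are 0 at the zero function.\<close>
  have "\<Delta> x (H x 0) (hilfer_integral \<rho> k \<gamma> (\<lambda>_. 0) x) = 0" if "x \<in> {1..T}" for x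
    using H3_max(2)[OF that] H3_zero[OF that] True
    by (simp add: hilfer_integral_def set_lebesgue_integral_def)
  then show ?thesis by (intro exI[of _ "\<lambda>_. 0"]) auto
next
  case False
  \<comment> \<open>\<open>M\<close> is attained as an absolute value, hence nonnegative.\<close>
  then have M: "0 < M" using H3_max(1) by auto
  define K where "K = \<rho> powr (- \<gamma> / k) / (\<gamma> * k_Gamma k \<gamma>) * (T powr \<rho> - 1) powr (\<gamma> / k)"
  define c where "c = c1 * c3 + c2 * K"
  have "0 \<le> K" using gamma by (simp add: K_def k_Gamma_nonneg)
  then have c0: "0 \<le> c" using H1_const by (simp add: c_def)
  have "c * r0 + M \<le> r0" using H4 by (simp add: c_def K_def algebra_simps)
  then have "c * r0 < 1 * r0" using M by simp
  then have c1: "c < 1" using r0 by (simp only: mult_less_cancel_right_pos)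
  define F where "F L x = \<Delta> x (H x (L x)) (hilfer_integral \<rho> k \<gamma> L x)" for L x
  obtain L where L: "continuous_on {1..T} L" "\<And>x. x \<in> {1..T} \<Longrightarrow> F L x = L x"
  proof (rule contraction_fixpoint_Icc[OF _ c0 c1, of 1 T F])
    fix f :: "real \<Rightarrow> real" assume f: "continuous_on {1..T} f"
    have "continuous_on {1..T} (\<lambda>x. (\<lambda>(x, l). H x l) (x, f x))"
      by (rule continuous_on_compose2[OF H1_cont(2)]) (auto intro!: continuous_intros f)
    then have "continuous_on {1..T} (\<lambda>x. (\<lambda>(x, h, j). \<Delta> x h j)
        (x, H x (f x), hilfer_integral \<rho> k \<gamma> f x))"
      using rho k gamma
      by (intro continuous_on_compose2[OF H1_cont(1)])
        (auto intro!: continuous_intros continuous_on_hilfer_integral f)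
    then show "continuous_on {1..T} (F f)" by (simp add: F_def[abs_def])
  next
    fix f g :: "real \<Rightarrow> real" and d x
    assume f: "continuous_on {1..T} f" and g: "continuous_on {1..T} g"
      and d: "\<And>y. y \<in> {1..T} \<Longrightarrow> \<bar>f y - g y\<bar> \<le> d" and x: "x \<in> {1..T}"
    have fx: "continuous_on {1..x} f" and gx: "continuous_on {1..x} g"
      using x by (auto intro: continuous_on_subset[OF f] continuous_on_subset[OF g])
    \<comment> \<open>The integral term is nonlocal and needs the bound \<open>d\<close> on all of
      \<open>{1..x}\<close>, whereas the \<open>H\<close> term needs it only at
      \<open>x\<close>.\<close>
    have "\<bar>hilfer_integral \<rho> k \<gamma> (\<lambda>t. f t - g t) x\<bar> \<le> K * d"
      unfolding K_def using rho k gamma x d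
      by (intro hilfer_integral_bound continuous_on_diff fx gx) auto
    then have J: "\<bar>hilfer_integral \<rho> k \<gamma> f x - hilfer_integral \<rho> k \<gamma> g x\<bar> \<le> K * d"
      using hilfer_integral_diff[OF rho(1) k(1) gamma(1) _ fx gx] x by simp
    have "\<bar>H x (f x) - H x (g x)\<bar> \<le> c3 * d"
      using H1_H[OF x, of "f x" "g x"] mult_left_mono[OF d[OF x] H1_const(3)] by simp
    \<comment> \<open>The two contributions \<open>c1 * (c3 * d)\<close> and
      \<open>c2 * (K * d)\<close> add up to \<open>c * d\<close>.\<close>
    from mult_left_mono[OF this H1_const(1)] mult_left_mono[OF J H1_const(2)]
    show "\<bar>F f x - F g x\<bar> \<le> c * d"
      using H1_Delta[OF x, of "H x (f x)" "hilfer_integral \<rho> k \<gamma> f x" "H x (g x)"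
          "hilfer_integral \<rho> k \<gamma> g x"]
      by (simp add: F_def c_def distrib_right mult.assoc)
  qed (use T in auto)
  then show ?thesis by (intro exI[of _ L]) (simp add: F_def)
qed

end
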